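(* Let $\beta\in\mathbb{R}^{mK}$ and $\rho\ge0$. The sparsified Hessian $H_\rho=H_\rho(\beta)$ has the same kernel as the exact Hessian $H=\nabla^2\mathcal{L}(\beta)$, namely $$\ker(H_\rho)=\ker(H)=\{d=(d_1^\top,\dots,d_K^\top)^\top\in\mathbb{R}^{mK}: d_k=c_k\mathbf{1}_m,\ c_k\in\mathbb{R},\ \forall k\in[K]\}.$$ Moreover, $H_\rho$ is symmetric and positive semidefinite, the gradient $g=\nabla\mathcal{L}(\beta)$ lies in $\ker(H_\rho)^\perp$ (so that the system $H_\rho d=-g$ is consistent), and $$\lambda_{\min}^{+}(H_\rho)\ \ge\ \frac{m}{\eta n}\min_{k\in[K]}(w_kp_k^2),\qquad \lambda_{\max}(H_\rho)\ \le\ \big(\max_{k\in[K]}w_k\big)\Big(\frac{1}{2\eta}+\frac1\tau\Big),$$ where $p_k=\min_{j\in[m]}[P_{k,\rho}]_{i^\star j}$ and $i^\star\in\arg\max_{i}v_i$ is the index used in the sparsification.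
   Context: $\lambda_{\min}^+(\cdot)$ and $\lambda_{\max}(\cdot)$ denote the smallest strictly positive and the largest eigenvalue of a real symmetric matrix (a lower bound on $\lambda^+_{\min}$ is read as vacuous if there is no positive eigenvalue). Let $n,m,K\ge 1$ be integers, $[K]=\{1,\dots,K\}$, $\eta,\tau>0$, and let $\Delta_d=\{x\in\mathbb{R}_+^d:\sum_i x_i=1\}$. Let $\mu_k\in\Delta_m$ ($k\in[K]$) have strictly positive entries, $C_k\in\mathbb{R}_+^{n\times m}$, $w_k>0$ with $\sum_{k=1}^K w_k=1$, and $\pi\in\Delta_n$ with strictly positive entries. $\mathbf{1}_m$ is the all-ones vector. For $\beta=(\beta_1^\top,\dots,\beta_K^\top)^\top\in\mathbb{R}^{mK}$ with $\beta_k\in\mathbb{R}^m$ define: - $[\alpha_k(\beta_k)]_i=-\eta\log\big(\sum_{j=1}^m[\mu_k]_j\exp(([\beta_k]_j-[C_k]_{ij})/\eta)\big)$ for $i\in[n]$, and $\Phi(\beta)=\sum_{k=1}^K w_k\alpha_k(\beta_k)\in\mathbb{R}^n$; - $\mathcal{L}(\beta)=-\sum_{k=1}^K w_k\langle\beta_k,\mu_k\rangle+\tau\log\big(\sum_{i=1}^n\pi_i\exp(-[\Phi(\beta)]_i/\tau)\big)$; - $v=v(\beta)\in\Delta_n$, $v_i=\pi_i\exp(-[\Phi(\beta)]_i/\tau)\big/\sum_{l=1}^n\pi_l\exp(-[\Phi(\beta)]_l/\tau)$; - $P_k=P_k(\beta_k)\in\mathbb{R}^{n\times m}$, $[P_k]_{ij}=\dfrac{[\mu_k]_j\exp(([\beta_k]_j-[C_k]_{ij})/\eta)}{\sum_{l=1}^m[\mu_k]_l\exp(([\beta_k]_l-[C_k]_{il})/\eta)}$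 (row-stochastic). The gradient $g=\nabla\mathcal{L}(\beta)$ has blocks $g_k=w_k(P_k^\top v-\mu_k)$. Sparsification with threshold $\rho\ge 0$: fix $i^\star\in\arg\max_{i\in[n]}v_i$. Put $[P_{k,\rho}]_{i^\star j}=[P_k]_{i^\star j}$ for all $j$ and, for $i\neq i^\star$, $$[P_{k,\rho}]_{ij}=\frac{[P_k]_{ij}\,\mathbf{1}\{[P_k]_{ij}\ge\rho\}}{\sum_{l=1}^m[P_k]_{il}\,\mathbf{1}\{[P_k]_{il}\ge\rho\}}.$$ It is assumed that these denominators are nonzero (each row $i\ne i^\star$ of each $P_k$ has an entry $\ge\rho$), so $P_{k,\rho}$ is row-stochastic. Let $\gamma_{k,\rho}=P_{k,\rho}^\top v$. The sparsified Hessian $H_\rho$ has $m\times m$ blocks $$[H_\rho]_{kr}=\tfrac{w_kw_r}{\tau}\big(P_{k,\rho}^\top\mathrm{diag}(v)P_{r,\rho}-\gamma_{k,\rho}\gamma_{r,\rho}^\top\big)+\mathbf{1}\{k=r\}\,\tfrac{w_k}{\eta}\big(\mathrm{diag}(\gamma_{k,\rho})-P_{k,\rho}^\top\mathrm{diag}(v)P_{k,\rho}\big).$$ For $\rho=0$ one has $P_{k,0}=P_k$ and $H_0=H=\nabla^2\mathcal{L}(\beta)$. *)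

theory Defs
  imports "HOL-Analysis.Analysis"
begin

text \<open>
  The index sets \<open>[n]\<close>, \<open>[m]\<close>, \<open>[K]\<close> are finite types \<open>'n\<close>, \<open>'m\<close>, \<open>'k\<close> (nonempty, as every type is).
  A stacked vector \<open>\<beta> = (\<beta>\<^sub>1, \<dots>, \<beta>\<^sub>K)\<close> of \<open>K\<close> blocks of length \<open>m\<close> is an element of
  \<open>real ^ ('k \<times> 'm)\<close>, the pair \<open>(k, j)\<close> indexing entry \<open>j\<close> of block \<open>k\<close>.
\<close>

definition block :: "real ^ ('k::finite \<times> 'm::finite) \<Rightarrow> 'k \<Rightarrow> real ^ 'm" where
  "block d k = (\<chi> j. d $ (k, j))"

definition prob_simplex :: "(real ^ 'd::finite) set" where
  "prob_simplex = {x. (\<forall>i. 0 \<le> x $ i) \<and> (\<Sum>i\<in>UNIV. x $ i) = 1}"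


subsection \<open>Matrices\<close>

definition diag :: "real ^ 'd::finite \<Rightarrow> real ^ 'd ^ 'd" where
  "diag x = (\<chi> i j. if i = j then x $ i else 0)"

definition outer :: "real ^ 'a::finite \<Rightarrow> real ^ 'b::finite \<Rightarrow> real ^ 'b ^ 'a" where
  "outer x y = (\<chi> i j. x $ i * y $ j)"

definition ker :: "real ^ 'd::finite ^ 'd \<Rightarrow> (real ^ 'd) set" where
  "ker A = {d. A *v d = 0}"

definition eigenvalues :: "real ^ 'd::finite ^ 'd \<Rightarrow> real set" where
  "eigenvalues A = {l. \<exists>x. x \<noteq> 0 \<and> A *v x = l *\<^sub>R x}"

text \<open>
  Only used for symmetric matrices, whose set of eigenvalues is finite and nonempty. The value of
  \<open>lambda_min_pos\<close> is meaningless if there is no positive eigenvalue.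
\<close>

definition lambda_max :: "real ^ 'd::finite ^ 'd \<Rightarrow> real" where
  "lambda_max A = Max (eigenvalues A)"

definition lambda_min_pos :: "real ^ 'd::finite ^ 'd \<Rightarrow> real" where
  "lambda_min_pos A = Min {l \<in> eigenvalues A. 0 < l}"

definition symmetric_matrix :: "real ^ 'd::finite ^ 'd \<Rightarrow> bool" where
  "symmetric_matrix A \<longleftrightarrow> transpose A = A"

definition psd_matrix :: "real ^ 'd::finite ^ 'd \<Rightarrow> bool" where
  "psd_matrix A \<longleftrightarrow> (\<forall>x. 0 \<le> x \<bullet> (A *v x))"


subsection \<open>Gradient and Hessian\<close>

text \<open>
  Only meaningful where \<open>f\<close> is (twice) differentiable, as the objective below is everywhere.
  Row \<open>a\<close>, column \<open>b\<close> of the Hessian is the derivative of the \<open>a\<close>-th partial in direction \<open>b\<close>.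
\<close>

definition gradient :: "(real ^ 'd::finite \<Rightarrow> real) \<Rightarrow> real ^ 'd \<Rightarrow> real ^ 'd" where
  "gradient f x = (THE g. GDERIV f x :> g)"

definition hessian :: "(real ^ 'd::finite \<Rightarrow> real) \<Rightarrow> real ^ 'd \<Rightarrow> real ^ 'd ^ 'd" where
  "hessian f x = jacobian (gradient f) (at x)"


subsection \<open>The objective function\<close>

definition alpha :: "real \<Rightarrow> real ^ 'm::finite \<Rightarrow> real ^ 'm ^ 'n::finite \<Rightarrow> real ^ 'm \<Rightarrow> real ^ 'n" where
  "alpha \<eta> \<mu> C b = (\<chi> i. - \<eta> * ln (\<Sum>j\<in>UNIV. \<mu> $ j * exp ((b $ j - C $ i $ j) / \<eta>)))"

definition Phi :: "real \<Rightarrow> ('k::finite \<Rightarrow> real ^ 'm::finite) \<Rightarrow> ('k \<Rightarrow> real ^ 'm ^ 'n::finite) \<Rightarrow> ('k \<Rightarrow> real)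
    \<Rightarrow> real ^ ('k \<times> 'm) \<Rightarrow> real ^ 'n" where
  "Phi \<eta> \<mu> C w \<beta> = (\<Sum>k\<in>UNIV. w k *\<^sub>R alpha \<eta> (\<mu> k) (C k) (block \<beta> k))"

definition objective :: "real \<Rightarrow> real \<Rightarrow> ('k::finite \<Rightarrow> real ^ 'm::finite) \<Rightarrow> ('k \<Rightarrow> real ^ 'm ^ 'n::finite)
    \<Rightarrow> ('k \<Rightarrow> real) \<Rightarrow> real ^ 'n \<Rightarrow> real ^ ('k \<times> 'm) \<Rightarrow> real" where
  "objective \<eta> \<tau> \<mu> C w \<pi> \<beta> =
     - (\<Sum>k\<in>UNIV. w k * (block \<beta> k \<bullet> \<mu> k))
     + \<tau> * ln (\<Sum>i\<in>UNIV. \<pi> $ i * exp (- (Phi \<eta> \<mu> C w \<beta> $ i) / \<tau>))"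

definition vvec :: "real \<Rightarrow> real \<Rightarrow> ('k::finite \<Rightarrow> real ^ 'm::finite) \<Rightarrow> ('k \<Rightarrow> real ^ 'm ^ 'n::finite)
    \<Rightarrow> ('k \<Rightarrow> real) \<Rightarrow> real ^ 'n \<Rightarrow> real ^ ('k \<times> 'm) \<Rightarrow> real ^ 'n" where
  "vvec \<eta> \<tau> \<mu> C w \<pi> \<beta> =
     (\<chi> i. \<pi> $ i * exp (- (Phi \<eta> \<mu> C w \<beta> $ i) / \<tau>)
           / (\<Sum>l\<in>UNIV. \<pi> $ l * exp (- (Phi \<eta> \<mu> C w \<beta> $ l) / \<tau>)))"

definition plan :: "real \<Rightarrow> real ^ 'm::finite \<Rightarrow> real ^ 'm ^ 'n::finite \<Rightarrow> real ^ 'm \<Rightarrow> real ^ 'm ^ 'n" where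
  "plan \<eta> \<mu> C b =
     (\<chi> i j. \<mu> $ j * exp ((b $ j - C $ i $ j) / \<eta>)
             / (\<Sum>l\<in>UNIV. \<mu> $ l * exp ((b $ l - C $ i $ l) / \<eta>)))"


subsection \<open>Sparsification\<close>

definition kept_mass :: "real \<Rightarrow> real ^ 'm::finite ^ 'n::finite \<Rightarrow> 'n \<Rightarrow> real" where
  "kept_mass \<rho> P i = (\<Sum>l\<in>UNIV. P $ i $ l * of_bool (\<rho> \<le> P $ i $ l))"

definition sparsify :: "real \<Rightarrow> 'n \<Rightarrow> real ^ 'm::finite ^ 'n::finite \<Rightarrow> real ^ 'm ^ 'n" where
  "sparsify \<rho> i\<^sub>0 P =
     (\<chi> i j. if i = i\<^sub>0 then P $ i $ j
             else P $ i $ j * of_bool (\<rho> \<le> P $ i $ j) / kept_mass \<rho> P i)"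

definition hess_block :: "real \<Rightarrow> real \<Rightarrow> ('k::finite \<Rightarrow> real) \<Rightarrow> real ^ 'n::finite
    \<Rightarrow> ('k \<Rightarrow> real ^ 'm::finite ^ 'n) \<Rightarrow> 'k \<Rightarrow> 'k \<Rightarrow> real ^ 'm ^ 'm" where
  "hess_block \<eta> \<tau> w v P k r =
     (w k * w r / \<tau>) *\<^sub>R (transpose (P k) ** diag v ** P r
                        - outer (transpose (P k) *v v) (transpose (P r) *v v))
     + (if k = r
        then (w k / \<eta>) *\<^sub>R (diag (transpose (P k) *v v) - transpose (P k) ** diag v ** P k)
        else 0)"

definition assemble :: "('k::finite \<Rightarrow> 'k \<Rightarrow> real ^ 'm::finite ^ 'm) \<Rightarrow> real ^ ('k \<times> 'm) ^ ('k \<times> 'm)" where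
  "assemble B = (\<chi> a b. B (fst a) (fst b) $ snd a $ snd b)"

text \<open>
  The index \<open>i\<^sub>0\<close> is a parameter here; it is meant to be some element of \<open>arg max\<close> of \<open>vvec\<close>.
\<close>

definition sparsified_hessian :: "real \<Rightarrow> real \<Rightarrow> ('k::finite \<Rightarrow> real ^ 'm::finite)
    \<Rightarrow> ('k \<Rightarrow> real ^ 'm ^ 'n::finite) \<Rightarrow> ('k \<Rightarrow> real) \<Rightarrow> real ^ 'n \<Rightarrow> real \<Rightarrow> 'n
    \<Rightarrow> real ^ ('k \<times> 'm) \<Rightarrow> real ^ ('k \<times> 'm) ^ ('k \<times> 'm)" where
  "sparsified_hessian \<eta> \<tau> \<mu> C w \<pi> \<rho> i\<^sub>0 \<beta> =
     assemble (hess_block \<eta> \<tau> w (vvec \<eta> \<tau> \<mu> C w \<pi> \<beta>)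
       (\<lambda>k. sparsify \<rho> i\<^sub>0 (plan \<eta> (\<mu> k) (C k) (block \<beta> k))))"

end

theory Submission
  imports Defs
begin

text \<open>
  Everything rests on reading the quadratic form of the (sparsified) Hessian as a sum of variances.
  For row-stochastic matrices \<open>P\<^sub>k\<close> and probability weights \<open>v\<close>, and with \<open>s = \<Sum>\<^sub>k w\<^sub>k P\<^sub>k d\<^sub>k\<close>,
  lemma \<open>quadratic_form\<close> says
  \[ d^\top H d = \frac{1}{\tau} \mathrm{Var}_v(s)
      + \sum_k \frac{w_k}{\eta} \sum_i v_i \mathrm{Var}_{P_k(i,\cdot)}(d_k). \]
  Sparsification keeps each \<open>P\<^sub>k\<close> row-stochastic and leaves row \<open>i\<^sup>\<star>\<close>, all of whose entries are positive,
  untouched; so the exact and the sparsified matrix are both instances of this one formula, and positive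
  semidefiniteness is immediate.

  If the form vanishes at \<open>d\<close>, then the variance of each \<open>d\<^sub>k\<close> under row \<open>i\<^sup>\<star>\<close> vanishes, and as that row is
  positive, \<open>d\<^sub>k\<close> is constant. Conversely, stochastic matrices preserve constants, so blockwise constant
  vectors are annihilated (lemma \<open>kernel\<close>). The gradient is orthogonal to them because the entries of
  \<open>P\<^sub>k\<^sup>\<top> v\<close> and of \<open>\<mu>\<^sub>k\<close> both sum to one, and a symmetric system is solvable when the right-hand side is
  orthogonal to the kernel.

  For the eigenvalue bounds, an eigenvector \<open>x\<close> of a positive eigenvalue is orthogonal to the kernel, so its
  blocks sum to zero. Writing a variance as a sum over pairs,
  \<open>2 Var\<^sub>p(x) = \<Sum>\<^sub>j\<^sub>l p\<^sub>j p\<^sub>l (x\<^sub>j - x\<^sub>l)\<^sup>2\<close>, shows that row \<open>i\<^sup>\<star>\<close> alone contributes at least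
  \<open>m p\<^sub>k\<^sup>2 |x\<^sub>k|\<^sup>2\<close> (lemma \<open>variance_ge\<close>), with weight \<open>v\<close> at \<open>i\<^sup>\<star>\<close> at least \<open>1/n\<close>. In the other direction a
  variance is at most half the squared norm (lemma \<open>variance_le_half_norm\<close>), while convexity of the square
  bounds \<open>Var\<^sub>v(s)\<close> by \<open>\<Sum>\<^sub>k w\<^sub>k |d\<^sub>k|\<^sup>2\<close> (lemma \<open>between_le\<close>).

  That \<open>H\<close> is the Hessian of the objective is a computation: \<open>v\<close> and the rows of \<open>P\<^sub>k\<close> are normalized
  exponential weights, and the potentials are logarithms of their normalizing constants, so two
  differentiation rules for such weights give both derivatives.
\<close>

section \<open>Variance of a finite distribution\<close>

definition variance :: "real ^ 'd::finite \<Rightarrow> real ^ 'd \<Rightarrow> real" where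
  "variance p x = (\<Sum>j\<in>UNIV. p $ j * (x $ j)\<^sup>2) - (p \<bullet> x)\<^sup>2"

text \<open>
  With \<open>s = -1\<close> this expresses twice the variance as a sum over pairs, from which lower bounds are read off
  termwise; with \<open>s = 1\<close> it bounds the squared mean from below by the diagonal terms, which gives the upper bound.
\<close>

lemma sum_pairs_square:
  fixes p x :: "real ^ 'd::finite"
  assumes "p \<in> prob_simplex"
  shows "(\<Sum>j\<in>UNIV. \<Sum>l\<in>UNIV. p $ j * p $ l * (x $ j + s * x $ l)\<^sup>2) =
    (1 + s\<^sup>2) * (\<Sum>j\<in>UNIV. p $ j * (x $ j)\<^sup>2) + 2 * s * (p \<bullet> x)\<^sup>2"
proof -
  let ?Q = "\<lambda>j. p $ j * (x $ j)\<^sup>2" and ?M = "\<lambda>j. p $ j * x $ j"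
  have p1: "(\<Sum>j\<in>UNIV. p $ j) = 1"
    using assms by (simp add: prob_simplex_def)
  have "p $ j * p $ l * (x $ j + s * x $ l)\<^sup>2 =
      ?Q j * p $ l + s\<^sup>2 * (p $ j * ?Q l) + 2 * s * (?M j * ?M l)" for j l
    by (simp add: power2_eq_square algebra_simps)
  then have "(\<Sum>j\<in>UNIV. \<Sum>l\<in>UNIV. p $ j * p $ l * (x $ j + s * x $ l)\<^sup>2) =
      sum ?Q UNIV * 1 + s\<^sup>2 * (1 * sum ?Q UNIV) + 2 * s * (sum ?M UNIV * sum ?M UNIV)"
    by (simp only: sum.distrib sum_distrib_left[symmetric] sum_distrib_right[symmetric] p1)
  then show ?thesis
    by (simp add: inner_vec_def power2_eq_square algebra_simps)
qed

lemma variance_pairs: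
  assumes "p \<in> prob_simplex"
  shows "2 * variance p x = (\<Sum>j\<in>UNIV. \<Sum>l\<in>UNIV. p $ j * p $ l * (x $ j - x $ l)\<^sup>2)"
  using sum_pairs_square[OF assms, of x "-1"] by (simp add: variance_def)

lemma variance_nonneg:
  assumes "p \<in> prob_simplex"
  shows "0 \<le> variance p x"
proof -
  have "0 \<le> (\<Sum>j\<in>UNIV. \<Sum>l\<in>UNIV. p $ j * p $ l * (x $ j - x $ l)\<^sup>2)"
    using assms by (intro sum_nonneg) (simp add: prob_simplex_def)
  then show ?thesis
    using variance_pairs[OF assms, of x] by simp
qed

lemma variance_eq_0_imp_const:
  assumes "p \<in> prob_simplex" and "\<And>j. 0 < p $ j" and "variance p x = 0"
  shows "x $ j = x $ l"
proof -
  let ?f = "\<lambda>j l. p $ j * p $ l * (x $ j - x $ l)\<^sup>2"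
  have nn: "0 \<le> ?f j l" for j l
    using assms(2)[of j] assms(2)[of l] by simp
  have "(\<Sum>j\<in>UNIV. \<Sum>l\<in>UNIV. ?f j l) = 0"
    using variance_pairs[OF assms(1), of x] assms(3) by simp
  moreover have "p $ j \<noteq> 0" for j
    using assms(2)[of j] by simp
  ultimately have "\<forall>j l. x $ j = x $ l"
    using nn by (simp add: sum_nonneg_eq_0_iff sum_nonneg)
  then show ?thesis by blast
qed

lemma variance_ge:
  fixes p x :: "real ^ 'd::finite"
  assumes "p \<in> prob_simplex" and "0 \<le> a" and "\<And>j. a \<le> p $ j" and "(\<Sum>j\<in>UNIV. x $ j) = 0"
  shows "real CARD('d) * a\<^sup>2 * (x \<bullet> x) \<le> variance p x"
proof -
  have "a\<^sup>2 * (x $ j - x $ l)\<^sup>2 \<le> p $ j * p $ l * (x $ j - x $ l)\<^sup>2" for j l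
    using assms(2,3) by (intro mult_right_mono) (auto simp: power2_eq_square intro!: mult_mono intro: order_trans)
  then have "(\<Sum>j\<in>UNIV. \<Sum>l\<in>UNIV. a\<^sup>2 * (x $ j - x $ l)\<^sup>2) \<le> 2 * variance p x"
    unfolding variance_pairs[OF assms(1)] by (intro sum_mono)
  moreover have "(\<Sum>j\<in>UNIV. \<Sum>l\<in>UNIV. a\<^sup>2 * (x $ j - x $ l)\<^sup>2) = 2 * real CARD('d) * a\<^sup>2 * (x \<bullet> x)"
  proof -
    have "a\<^sup>2 * (x $ j - x $ l)\<^sup>2 =
        a\<^sup>2 * (x $ j)\<^sup>2 + a\<^sup>2 * (x $ l)\<^sup>2 - 2 * a\<^sup>2 * (x $ j * x $ l)" for j l
      by (simp add: power2_eq_square algebra_simps)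
    then show ?thesis
      by (simp add: sum.distrib sum_subtractf sum_distrib_left[symmetric] assms(4)
          inner_vec_def power2_eq_square)
  qed
  ultimately show ?thesis by simp
qed

text \<open>
  By the pair identity with a plus sign, keeping only the diagonal terms, the variance is at most
  \<open>\<Sum>\<^sub>j 2 p\<^sub>j (1 - p\<^sub>j) x\<^sub>j\<^sup>2\<close>, and \<open>p (1 - p) \<le> 1/4\<close>.
\<close>

lemma variance_le_half_norm:
  assumes "p \<in> prob_simplex"
  shows "variance p x \<le> (x \<bullet> x) / 2"
proof -
  have p: "0 \<le> p $ j" for j
    using assms by (simp add: prob_simplex_def)
  have "(\<Sum>j\<in>UNIV. p $ j * p $ j * (2 * x $ j)\<^sup>2)
      \<le> (\<Sum>j\<in>UNIV. \<Sum>l\<in>UNIV. p $ j * p $ l * (x $ j + x $ l)\<^sup>2)"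
  proof (rule sum_mono)
    fix j
    show "p $ j * p $ j * (2 * x $ j)\<^sup>2 \<le> (\<Sum>l\<in>UNIV. p $ j * p $ l * (x $ j + x $ l)\<^sup>2)"
      using member_le_sum[of j UNIV "\<lambda>l. p $ j * p $ l * (x $ j + x $ l)\<^sup>2"] p by simp
  qed
  also have "\<dots> = 2 * (\<Sum>j\<in>UNIV. p $ j * (x $ j)\<^sup>2) + 2 * (p \<bullet> x)\<^sup>2"
    using sum_pairs_square[OF assms, of x 1] by simp
  finally have "variance p x \<le> 2 * (\<Sum>j\<in>UNIV. p $ j * (x $ j)\<^sup>2) - (\<Sum>j\<in>UNIV. p $ j * p $ j * (2 * x $ j)\<^sup>2) / 2"
    by (simp add: variance_def)
  also have "\<dots> = (\<Sum>j\<in>UNIV. 2 * (p $ j * (1 - p $ j)) * (x $ j)\<^sup>2)"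
    by (simp add: sum_distrib_left sum_divide_distrib sum_subtractf[symmetric] power2_eq_square algebra_simps)
  also have "\<dots> \<le> (\<Sum>j\<in>UNIV. 1 / 2 * (x $ j)\<^sup>2)"
  proof (intro sum_mono mult_right_mono)
    fix j
    show "2 * (p $ j * (1 - p $ j)) \<le> 1 / 2"
      using zero_le_square[of "p $ j - 1 / 2"] by (simp add: algebra_simps)
  qed simp
  also have "\<dots> = (x \<bullet> x) / 2"
    by (simp add: inner_vec_def power2_eq_square sum_divide_distrib)
  finally show ?thesis .
qed

lemma mean_square_le:
  assumes "p \<in> prob_simplex"
  shows "(p \<bullet> x)\<^sup>2 \<le> (\<Sum>j\<in>UNIV. p $ j * (x $ j)\<^sup>2)"
  using variance_nonneg[OF assms, of x] by (simp add: variance_def)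

lemma mean_square_le_norm:
  assumes "p \<in> prob_simplex"
  shows "(p \<bullet> x)\<^sup>2 \<le> x \<bullet> x"
proof -
  have "p $ j \<le> 1" for j
    using member_le_sum[of j UNIV "($) p"] assms by (simp add: prob_simplex_def)
  then have "(\<Sum>j\<in>UNIV. p $ j * (x $ j)\<^sup>2) \<le> (\<Sum>j\<in>UNIV. (x $ j)\<^sup>2)"
    by (intro sum_mono mult_left_le_one_le) (use assms in \<open>auto simp: prob_simplex_def\<close>)
  with mean_square_le[OF assms, of x] show ?thesis
    by (simp add: inner_vec_def power2_eq_square)
qed

section \<open>Symmetric matrices\<close>

lemma symmetric_inner:
  assumes "symmetric_matrix A"
  shows "(A *v x) \<bullet> y = x \<bullet> (A *v y)"
  using assms by (metis dot_lmul_matrix symmetric_matrix_def transpose_matrix_vector)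

text \<open>
  Eigenvectors of distinct eigenvalues are orthogonal, hence independent, so there are at most as many eigenvalues
  as dimensions. Finiteness is what gives the \<open>Max\<close> and \<open>Min\<close> over the spectrum their meaning.
\<close>

lemma finite_eigenvalues:
  assumes "symmetric_matrix A"
  shows "finite (eigenvalues A)"
proof -
  have "\<forall>l\<in>eigenvalues A. \<exists>x. x \<noteq> 0 \<and> A *v x = l *\<^sub>R x"
    by (simp add: eigenvalues_def)
  then obtain f where f: "\<And>l. l \<in> eigenvalues A \<Longrightarrow> f l \<noteq> 0 \<and> A *v f l = l *\<^sub>R f l"
    using bchoice by (metis (mono_tags, lifting))
  have orth: "f l \<bullet> f r = 0" if "l \<in> eigenvalues A" "r \<in> eigenvalues A" "l \<noteq> r" for l r
    using symmetric_inner[OF assms, of "f l" "f r"] f that by auto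
  have "inj_on f (eigenvalues A)"
    by (rule inj_onI) (metis orth f inner_eq_zero_iff)
  moreover have "independent (f ` eigenvalues A)"
    by (rule pairwise_orthogonal_independent)
      (auto simp: pairwise_def orthogonal_def dest: f intro!: orth)
  ultimately show ?thesis
    using finite_imageD independent_imp_finite by blast
qed

lemma eigenvector_orthogonal_kernel:
  assumes "symmetric_matrix A" and "A *v x = l *\<^sub>R x" and "l \<noteq> 0" and "y \<in> ker A"
  shows "x \<bullet> y = 0"
  using symmetric_inner[OF assms(1), of x y] assms(2-4) by (simp add: ker_def)

text \<open>
  The range of a self-adjoint map is the orthogonal complement of its kernel.
\<close>

lemma symmetric_solvable:
  assumes "symmetric_matrix A" and "b \<in> orthogonal_comp (ker A)"
  shows "\<exists>x. A *v x = b"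
proof -
  have "adjoint ((*v) A) = (*v) A"
    by (rule adjoint_unique) (simp add: symmetric_inner[OF assms(1)])
  then have "ker A = orthogonal_comp (range ((*v) A))"
    using ker_orthogonal_comp_adjoint[of "(*v) A"] by (auto simp: ker_def vimage_def)
  then have "b \<in> range ((*v) A)"
    using assms(2) orthogonal_comp_self[of "range ((*v) A)"]
    by (simp add: linear_subspace_image)
  then show ?thesis by auto
qed

section \<open>Differentiating Gibbs weights\<close>

text \<open>
  The softmax of \<open>f\<close> with prior weights \<open>a\<close>. The rows of each plan and the vector \<open>vvec\<close> are both of this form.
\<close>

definition gibbs :: "('i::finite \<Rightarrow> real) \<Rightarrow> ('i \<Rightarrow> real) \<Rightarrow> 'i \<Rightarrow> real" where
  "gibbs a f i = a i * exp (f i) / (\<Sum>l\<in>UNIV. a l * exp (f l))"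

lemma gibbs_pos:
  assumes "\<And>i. 0 < a i"
  shows "0 < gibbs a f i"
  unfolding gibbs_def using assms by (auto intro!: divide_pos_pos sum_pos)

lemma sum_gibbs:
  assumes "\<And>i. 0 < a i"
  shows "(\<Sum>i\<in>UNIV. gibbs a f i) = 1"
proof -
  have "0 < (\<Sum>l\<in>UNIV. a l * exp (f l))"
    using assms by (intro sum_pos) auto
  then show ?thesis
    by (simp add: gibbs_def sum_divide_distrib[symmetric])
qed

lemma has_derivative_log_partition:
  fixes f :: "'i::finite \<Rightarrow> 'a::real_normed_vector \<Rightarrow> real"
  assumes "\<And>i. 0 < a i" and "\<And>i. (f i has_derivative f' i) (at x)"
  shows "((\<lambda>x. ln (\<Sum>i\<in>UNIV. a i * exp (f i x))) has_derivative
    (\<lambda>h. \<Sum>i\<in>UNIV. gibbs a (\<lambda>i. f i x) i * f' i h)) (at x)"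
proof -
  have Z: "0 < (\<Sum>i\<in>UNIV. a i * exp (f i x))"
    using assms(1) by (intro sum_pos) auto
  show ?thesis
    by (rule derivative_eq_intros assms(2) Z refl)+
      (auto simp: gibbs_def sum_distrib_left sum_divide_distrib divide_inverse mult_ac intro!: ext sum.cong)
qed

text \<open>
  Moving the normalizing constant into the exponent reduces the derivative of the weights to that of the
  log-partition function.
\<close>

lemma gibbs_eq_exp:
  assumes "\<And>i. 0 < a i"
  shows "gibbs a f i = a i * exp (f i - ln (\<Sum>l\<in>UNIV. a l * exp (f l)))"
proof -
  have "0 < (\<Sum>l\<in>UNIV. a l * exp (f l))"
    using assms by (intro sum_pos) auto
  then show ?thesis
    by (simp add: gibbs_def exp_diff)
qed

lemma has_derivative_gibbs:
  fixes f :: "'i::finite \<Rightarrow> 'a::real_normed_vector \<Rightarrow> real"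
  assumes "\<And>i. 0 < a i" and "\<And>i. (f i has_derivative f' i) (at x)"
  shows "((\<lambda>x. gibbs a (\<lambda>i. f i x) i) has_derivative
    (\<lambda>h. gibbs a (\<lambda>i. f i x) i * (f' i h - (\<Sum>l\<in>UNIV. gibbs a (\<lambda>i. f i x) l * f' l h)))) (at x)"
proof -
  have "((\<lambda>x. a i * exp (f i x - ln (\<Sum>l\<in>UNIV. a l * exp (f l x)))) has_derivative
    (\<lambda>h. a i * exp (f i x - ln (\<Sum>l\<in>UNIV. a l * exp (f l x)))
      * (f' i h - (\<Sum>l\<in>UNIV. gibbs a (\<lambda>i. f i x) l * f' l h)))) (at x)"
    by (rule has_derivative_log_partition[OF assms] assms(2) derivative_eq_intros refl)+
      (simp add: fun_eq_iff mult_ac)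
  then show ?thesis
    by (simp only: gibbs_eq_exp[OF assms(1)])
qed

section \<open>The Hessian of a family of stochastic matrices\<close>

text \<open>
  The vector \<open>s\<close> of the overview. Up to sign it is also the derivative of \<open>Phi\<close> in direction \<open>d\<close>, which
  is why it appears both in the Hessian and in the differentiation below.
\<close>

definition mixture :: "('k::finite \<Rightarrow> real) \<Rightarrow> ('k \<Rightarrow> real ^ 'm::finite ^ 'n::finite)
    \<Rightarrow> real ^ ('k \<times> 'm) \<Rightarrow> real ^ 'n" where
  "mixture w P d = (\<Sum>k\<in>UNIV. w k *\<^sub>R (P k *v block d k))"

lemma sum_UNIV_prod:
  fixes f :: "('k::finite \<times> 'm::finite) \<Rightarrow> real"
  shows "sum f UNIV = (\<Sum>k\<in>UNIV. \<Sum>j\<in>UNIV. f (k, j))"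
  by (simp add: sum.cartesian_product UNIV_Times_UNIV[symmetric] del: UNIV_Times_UNIV)

lemma inner_blocks: "x \<bullet> y = (\<Sum>k\<in>UNIV. block x k \<bullet> block y k)"
  by (simp add: inner_vec_def sum_UNIV_prod block_def)

lemma mixture_nth:
  "mixture w P d $ i = (\<Sum>k\<in>UNIV. w k * (P k $ i \<bullet> block d k))"
  by (simp add: mixture_def matrix_vector_mult_def inner_vec_def)

lemma hess_block_entry:
  fixes P :: "'k::finite \<Rightarrow> real ^ 'm::finite ^ 'n::finite"
  shows "hess_block \<eta> \<tau> w v P k r $ j $ l =
    w k * w r / \<tau> * ((\<Sum>i\<in>UNIV. v $ i * P k $ i $ j * P r $ i $ l)
        - (\<Sum>i\<in>UNIV. v $ i * P k $ i $ j) * (\<Sum>i\<in>UNIV. v $ i * P r $ i $ l))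
    + (if k = r then w k / \<eta> * ((if j = l then \<Sum>i\<in>UNIV. v $ i * P k $ i $ j else 0)
        - (\<Sum>i\<in>UNIV. v $ i * P k $ i $ j * P k $ i $ l)) else 0)"
proof -
  have "(transpose (P k) ** diag v ** P r) $ j $ l = (\<Sum>i\<in>UNIV. v $ i * P k $ i $ j * P r $ i $ l)" for k r j l
    by (simp add: matrix_matrix_mult_def transpose_def diag_def if_distrib[where f = "(*) _"] mult_ac cong: if_cong)
  moreover have "(transpose (P r) *v v) $ l = (\<Sum>i\<in>UNIV. v $ i * P r $ i $ l)" for r l
    by (simp add: vector_matrix_mult_def mult_ac)
  moreover have "diag x $ j $ l = (if j = l then x $ j else 0)" for x :: "real ^ 'm" and j l
    by (simp add: diag_def)
  ultimately show ?thesis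
    by (simp add: hess_block_def outer_def)
qed

lemma symmetric_assemble_hess_block:
  "symmetric_matrix (assemble (hess_block \<eta> \<tau> w v P))"
proof -
  have "hess_block \<eta> \<tau> w v P r k $ l $ j = hess_block \<eta> \<tau> w v P k r $ j $ l" for k r j l
    unfolding hess_block_entry by (simp add: mult_ac)
  then show ?thesis
    by (simp add: symmetric_matrix_def assemble_def transpose_def)
qed

text \<open>
  This product is shaped to serve twice: as the derivative of the gradient, whose product rule
  yields exactly these two summands, and as the starting point for the quadratic form.
\<close>

lemma assemble_hess_block_mult:
  "(assemble (hess_block \<eta> \<tau> w v P) *v d) $ (k, j) =
    w k * (\<Sum>i\<in>UNIV. v $ i * P k $ i $ j *
      ((mixture w P d $ i - v \<bullet> mixture w P d) / \<tau> + (d $ (k, j) - P k $ i \<bullet> block d k) / \<eta>))"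
proof -
  define Q where "Q r l = (\<Sum>i\<in>UNIV. v $ i * P k $ i $ j * P r $ i $ l)" for r l
  define G where "G r l = (\<Sum>i\<in>UNIV. v $ i * P r $ i $ l)" for r l
  have "(assemble (hess_block \<eta> \<tau> w v P) *v d) $ (k, j) =
      (\<Sum>r\<in>UNIV. \<Sum>l\<in>UNIV. hess_block \<eta> \<tau> w v P k r $ j $ l * d $ (r, l))"
    by (simp add: matrix_vector_mult_def assemble_def sum_UNIV_prod)
  also have "\<dots> = (\<Sum>r\<in>UNIV. \<Sum>l\<in>UNIV. w k / \<tau> * (w r * (Q r l * d $ (r, l)))
      - w k / \<tau> * G k j * (w r * (G r l * d $ (r, l)))
      + (if r = k then w k / \<eta> * ((if j = l then G k j * d $ (k, l) else 0) - Q k l * d $ (k, l)) else 0))"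
    unfolding hess_block_entry Q_def[symmetric] G_def[symmetric]
    by (intro sum.cong refl) (auto simp: algebra_simps)
  also have "\<dots> = w k / \<tau> * (\<Sum>r\<in>UNIV. w r * (\<Sum>l\<in>UNIV. Q r l * d $ (r, l)))
      - w k / \<tau> * G k j * (\<Sum>r\<in>UNIV. w r * (\<Sum>l\<in>UNIV. G r l * d $ (r, l)))
      + w k / \<eta> * (G k j * d $ (k, j) - (\<Sum>l\<in>UNIV. Q k l * d $ (k, l)))"
  proof -
    have "(\<Sum>r\<in>UNIV. \<Sum>l\<in>UNIV. if r = k then w k / \<eta> * ((if j = l then G k j * d $ (k, l) else 0) - Q k l * d $ (k, l)) else 0)
      = (\<Sum>r\<in>UNIV. if r = k then \<Sum>l\<in>UNIV. w k / \<eta> * ((if j = l then G k j * d $ (k, l) else 0) - Q k l * d $ (k, l)) else 0)"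
      by (intro sum.cong) auto
    also have "\<dots> = w k / \<eta> * (G k j * d $ (k, j) - (\<Sum>l\<in>UNIV. Q k l * d $ (k, l)))"
      unfolding sum_distrib_left[symmetric] sum_subtractf by simp
    finally show ?thesis
      by (simp only: sum.distrib sum_subtractf sum_distrib_left)
  qed
  also have "\<dots> = w k / \<tau> * (\<Sum>i\<in>UNIV. v $ i * P k $ i $ j * mixture w P d $ i)
      - w k / \<tau> * G k j * (v \<bullet> mixture w P d)
      + w k / \<eta> * (G k j * d $ (k, j) - (\<Sum>i\<in>UNIV. v $ i * P k $ i $ j * (P k $ i \<bullet> block d k)))"
  proof -
    have Q: "(\<Sum>l\<in>UNIV. Q r l * d $ (r, l)) =
        (\<Sum>i\<in>UNIV. v $ i * P k $ i $ j * (P r $ i \<bullet> block d r))" for r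
      unfolding Q_def inner_vec_def block_def sum_distrib_right sum_distrib_left
      by (subst sum.swap) (simp add: mult_ac)
    have G: "(\<Sum>l\<in>UNIV. G r l * d $ (r, l)) = (\<Sum>i\<in>UNIV. v $ i * (P r $ i \<bullet> block d r))" for r
      unfolding G_def inner_vec_def block_def sum_distrib_right sum_distrib_left
      by (subst sum.swap) (simp add: mult_ac)
    have "(\<Sum>r\<in>UNIV. w r * (\<Sum>i\<in>UNIV. v $ i * P k $ i $ j * (P r $ i \<bullet> block d r))) =
        (\<Sum>i\<in>UNIV. v $ i * P k $ i $ j * mixture w P d $ i)"
      unfolding mixture_nth sum_distrib_left by (subst sum.swap) (simp add: mult_ac)
    moreover have "(\<Sum>r\<in>UNIV. w r * (\<Sum>i\<in>UNIV. v $ i * (P r $ i \<bullet> block d r))) = v \<bullet> mixture w P d"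
      unfolding inner_vec_def[of v] mixture_nth sum_distrib_left
      by (subst sum.swap) (simp add: sum_distrib_left mult_ac)
    ultimately show ?thesis
      by (simp only: Q G)
  qed
  also have "\<dots> = (\<Sum>i\<in>UNIV. w k / \<tau> * (v $ i * P k $ i $ j * mixture w P d $ i)
      - w k / \<tau> * (v $ i * P k $ i $ j) * (v \<bullet> mixture w P d)
      + w k / \<eta> * (v $ i * P k $ i $ j * d $ (k, j) - v $ i * P k $ i $ j * (P k $ i \<bullet> block d k)))"
    unfolding G_def sum_distrib_right sum_distrib_left sum.distrib sum_subtractf
      right_diff_distrib by simp
  also have "\<dots> = w k * (\<Sum>i\<in>UNIV. v $ i * P k $ i $ j *
      ((mixture w P d $ i - v \<bullet> mixture w P d) / \<tau> + (d $ (k, j) - P k $ i \<bullet> block d k) / \<eta>))"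
    unfolding sum_distrib_left
    by (intro sum.cong refl) (simp add: diff_divide_distrib algebra_simps)
  finally show ?thesis .
qed

text \<open>
  Only stochasticity of the matrices matters for the spectrum, so the exact plans and the sparsified ones are
  treated together here. In the applications \<open>i0\<close> below is the row protected from sparsification.
\<close>

locale stochastic_family =
  fixes \<eta> \<tau> :: real and w :: "'k::finite \<Rightarrow> real" and v :: "real ^ 'n::finite"
    and P :: "'k \<Rightarrow> real ^ 'm::finite ^ 'n"
  assumes eta: "0 < \<eta>" and tau: "0 < \<tau>"
    and w: "\<And>k. 0 < w k" "sum w UNIV = 1"
    and v: "v \<in> prob_simplex"
    and P: "\<And>k i. P k $ i \<in> prob_simplex"
begin

abbreviation H :: "real ^ ('k \<times> 'm) ^ ('k \<times> 'm)" where
  "H \<equiv> assemble (hess_block \<eta> \<tau> w v P)"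

text \<open>
  The form splits as in the law of total variance: the first term is the variance between the rows \<open>i\<close> of the mixed conditional means,
  the second collects the variances within the rows.
\<close>

lemma quadratic_form:
  "d \<bullet> (H *v d) = variance v (mixture w P d) / \<tau>
     + (\<Sum>k\<in>UNIV. w k / \<eta> * (\<Sum>i\<in>UNIV. v $ i * variance (P k $ i) (block d k)))"
proof -
  let ?s = "mixture w P d" and ?a = "\<lambda>k i. P k $ i \<bullet> block d k"
  have "d \<bullet> (H *v d) = (\<Sum>k\<in>UNIV. \<Sum>j\<in>UNIV. \<Sum>i\<in>UNIV. w k * v $ i * (P k $ i $ j * d $ (k, j) * ((?s $ i - v \<bullet> ?s) / \<tau>)
      + (P k $ i $ j * (d $ (k, j))\<^sup>2 - P k $ i $ j * d $ (k, j) * ?a k i) / \<eta>))"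
    unfolding inner_vec_def[of d] sum_UNIV_prod assemble_hess_block_mult
    by (simp add: sum_distrib_left power2_eq_square diff_divide_distrib algebra_simps)
  also have "\<dots> = (\<Sum>k\<in>UNIV. \<Sum>i\<in>UNIV. \<Sum>j\<in>UNIV. w k * v $ i * (P k $ i $ j * d $ (k, j) * ((?s $ i - v \<bullet> ?s) / \<tau>)
      + (P k $ i $ j * (d $ (k, j))\<^sup>2 - P k $ i $ j * d $ (k, j) * ?a k i) / \<eta>))"
    by (subst sum.swap) (rule refl)
  also have "\<dots> = (\<Sum>k\<in>UNIV. \<Sum>i\<in>UNIV. w k * v $ i * (?a k i * ((?s $ i - v \<bullet> ?s) / \<tau>)
      + variance (P k $ i) (block d k) / \<eta>))"
  proof -
    have a: "(\<Sum>j\<in>UNIV. P k $ i $ j * d $ (k, j)) = ?a k i" for k i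
      by (simp add: inner_vec_def block_def)
    show ?thesis
      by (simp only: sum_distrib_left[symmetric] sum_distrib_right[symmetric]
         sum.distrib sum_subtractf sum_divide_distrib[symmetric] a)
        (simp add: variance_def block_def power2_eq_square)
  qed
  also have "\<dots> = (\<Sum>k\<in>UNIV. \<Sum>i\<in>UNIV. v $ i * ((?s $ i - v \<bullet> ?s) / \<tau>) * (w k * ?a k i))
      + (\<Sum>k\<in>UNIV. w k / \<eta> * (\<Sum>i\<in>UNIV. v $ i * variance (P k $ i) (block d k)))"
    by (simp add: sum.distrib[symmetric] sum_distrib_left algebra_simps)
  also have "(\<Sum>k\<in>UNIV. \<Sum>i\<in>UNIV. v $ i * ((?s $ i - v \<bullet> ?s) / \<tau>) * (w k * ?a k i))
     = (\<Sum>i\<in>UNIV. v $ i * ((?s $ i - v \<bullet> ?s) / \<tau>) * ?s $ i)"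
    by (subst sum.swap) (simp add: mixture_nth sum_distrib_left)
  also have "\<dots> = (\<Sum>i\<in>UNIV. (v $ i * (?s $ i)\<^sup>2 - (v \<bullet> ?s) * (v $ i * ?s $ i)) / \<tau>)"
    by (intro sum.cong) (auto simp: power2_eq_square diff_divide_distrib algebra_simps)
  also have "\<dots> = variance v ?s / \<tau>"
    by (simp add: sum_divide_distrib[symmetric] sum_subtractf sum_distrib_left[symmetric]
      variance_def inner_vec_def[of v] power2_eq_square)
  finally show ?thesis .
qed

lemma v_nonneg: "0 \<le> v $ i"
  using v by (simp add: prob_simplex_def)

lemma within_nonneg: "0 \<le> w k / \<eta> * (\<Sum>i\<in>UNIV. v $ i * variance (P k $ i) (block d k))"
  using eta w(1)[of k] by (intro mult_nonneg_nonneg sum_nonneg v_nonneg variance_nonneg P) auto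

lemma within_ge_row:
  "w k / \<eta> * (v $ i * variance (P k $ i) (block d k))
    \<le> w k / \<eta> * (\<Sum>i\<in>UNIV. v $ i * variance (P k $ i) (block d k))"
  using eta w(1)[of k]
  by (intro mult_left_mono member_le_sum) (auto intro!: mult_nonneg_nonneg v_nonneg variance_nonneg P)

lemma quadratic_form_ge_row:
  "(\<Sum>k\<in>UNIV. w k / \<eta> * (v $ i * variance (P k $ i) (block d k))) \<le> d \<bullet> (H *v d)"
proof -
  have "0 \<le> variance v (mixture w P d) / \<tau>"
    using tau by (simp add: variance_nonneg v)
  moreover have "(\<Sum>k\<in>UNIV. w k / \<eta> * (v $ i * variance (P k $ i) (block d k)))
      \<le> (\<Sum>k\<in>UNIV. w k / \<eta> * (\<Sum>i\<in>UNIV. v $ i * variance (P k $ i) (block d k)))"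
    by (intro sum_mono within_ge_row)
  ultimately show ?thesis
    unfolding quadratic_form by linarith
qed

lemma psd: "psd_matrix H"
  unfolding psd_matrix_def quadratic_form
  using tau within_nonneg by (auto intro!: add_nonneg_nonneg sum_nonneg simp: variance_nonneg v)

text \<open>
  One row that carries positive weight and has positive entries in every matrix already forces the kernel to
  consist of blockwise constant vectors, because its variances alone bound the quadratic form from below.
\<close>

lemma kernel:
  assumes "0 < v $ i0" and "\<And>k j. 0 < P k $ i0 $ j"
  shows "ker H = {d. \<exists>c. \<forall>k. block d k = c k *\<^sub>R 1}"
proof (intro set_eqI iffI)
  fix d :: "real ^ ('k \<times> 'm)"
  assume "d \<in> ker H"
  then have "d \<bullet> (H *v d) = 0"
    by (simp add: ker_def)
  then have le: "(\<Sum>k\<in>UNIV. w k / \<eta> * (v $ i0 * variance (P k $ i0) (block d k))) \<le> 0"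
    using quadratic_form_ge_row[of i0 d] by simp
  have nn: "0 \<le> w k / \<eta> * (v $ i0 * variance (P k $ i0) (block d k))" for k
    using w(1)[of k] eta assms(1) variance_nonneg[OF P] by simp
  then have "(\<Sum>k\<in>UNIV. w k / \<eta> * (v $ i0 * variance (P k $ i0) (block d k))) = 0"
    by (intro antisym le sum_nonneg nn)
  then have "w k / \<eta> * (v $ i0 * variance (P k $ i0) (block d k)) = 0" for k
    by (rule sum_nonneg_0[rotated 2]) (rule nn UNIV_I finite)+
  moreover have "w k \<noteq> 0" for k
    using w(1)[of k] by simp
  ultimately have "variance (P k $ i0) (block d k) = 0" for k
    using eta assms(1) by simp
  then have "block d k $ j = block d k $ l" for k j l
    using variance_eq_0_imp_const[OF P assms(2)] by blast
  then have "block d k = (block d k $ undefined) *\<^sub>R 1" for k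
    by (simp add: vec_eq_iff)
  then show "d \<in> {d. \<exists>c. \<forall>k. block d k = c k *\<^sub>R 1}"
    by (intro CollectI exI[of _ "\<lambda>k. block d k $ undefined"]) blast
next
  fix d :: "real ^ ('k \<times> 'm)"
  assume "d \<in> {d. \<exists>c. \<forall>k. block d k = c k *\<^sub>R 1}"
  then obtain c where c: "\<And>k. block d k = c k *\<^sub>R 1"
    by blast
  have P1: "P k $ i \<bullet> block d k = c k" for k i
    using P[of k i] by (simp add: c inner_vec_def prob_simplex_def sum_distrib_right[symmetric])
  have dc: "d $ (k, j) = c k" for k j
    using arg_cong[OF c[of k], of "\<lambda>x. x $ j"] by (simp add: block_def)
  have s: "mixture w P d $ i = (\<Sum>k\<in>UNIV. w k * c k)" for i
    by (simp add: mixture_nth P1)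
  have "v \<bullet> mixture w P d = (\<Sum>k\<in>UNIV. w k * c k)"
    using v unfolding inner_vec_def s
    by (simp add: sum_distrib_right[symmetric] prob_simplex_def)
  then have "(H *v d) $ (k, j) = 0" for k j
    unfolding assemble_hess_block_mult by (simp add: s P1 dc)
  then show "d \<in> ker H"
    by (simp add: ker_def vec_eq_iff)
qed

lemma max_weight_ge_inverse_card:
  assumes "\<And>i. v $ i \<le> v $ i0"
  shows "1 / real CARD('n) \<le> v $ i0"
proof -
  have "1 = (\<Sum>i\<in>UNIV. v $ i)"
    using v by (simp add: prob_simplex_def)
  also have "\<dots> \<le> real CARD('n) * v $ i0"
    using sum_bounded_above[of UNIV "($) v" "v $ i0"] assms by simp
  finally show ?thesis
    by (simp add: field_simps)
qed

text \<open>
  The between-row variance and every row but \<open>i0\<close> are dropped; the remaining variances are bounded through the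
  lower bounds \<open>p k\<close> on the entries of that row, and the weight of row \<open>i0\<close> by \<open>1/n\<close>, since a largest weight is at least the average.
\<close>

lemma quadratic_form_ge:
  fixes d :: "real ^ ('k \<times> 'm)"
  assumes "\<And>i. v $ i \<le> v $ i0" and "\<And>k. 0 \<le> p k" and "\<And>k j. p k \<le> P k $ i0 $ j"
    and "\<And>k. (\<Sum>j\<in>UNIV. block d k $ j) = 0" and "\<And>k. q \<le> w k * (p k)\<^sup>2" and "0 \<le> q"
  shows "real CARD('m) / (\<eta> * real CARD('n)) * q * (d \<bullet> d) \<le> d \<bullet> (H *v d)"
proof -
  have "real CARD('m) / (\<eta> * real CARD('n)) * q * (block d k \<bullet> block d k)
      \<le> w k / \<eta> * (v $ i0 * variance (P k $ i0) (block d k))" for k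
  proof -
    have "real CARD('m) / (\<eta> * real CARD('n)) * q * (block d k \<bullet> block d k)
        \<le> real CARD('m) / (\<eta> * real CARD('n)) * (w k * (p k)\<^sup>2) * (block d k \<bullet> block d k)"
      using assms(5)[of k] eta by (intro mult_right_mono mult_left_mono) auto
    also have "\<dots> = w k / \<eta> * (1 / real CARD('n) * (real CARD('m) * (p k)\<^sup>2 * (block d k \<bullet> block d k)))"
      by simp
    also have "\<dots> \<le> w k / \<eta> * (v $ i0 * variance (P k $ i0) (block d k))"
      using eta w(1)[of k] max_weight_ge_inverse_card[OF assms(1)] variance_ge[OF P assms(2,3,4), of k k] v_nonneg[of i0]
      by (intro mult_left_mono mult_mono) auto
    finally show ?thesis .
  qed
  then have "(\<Sum>k\<in>UNIV. real CARD('m) / (\<eta> * real CARD('n)) * q * (block d k \<bullet> block d k))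
      \<le> (\<Sum>k\<in>UNIV. w k / \<eta> * (v $ i0 * variance (P k $ i0) (block d k)))"
    by (rule sum_mono)
  with quadratic_form_ge_row[of i0 d] show ?thesis
    unfolding inner_blocks[of d d] sum_distrib_left by linarith
qed

text \<open>
  The variance is at most the second moment, and Jensen's inequality is used twice: for the convex combination
  over \<open>k\<close> and for the conditional means within a row.
\<close>

lemma between_le:
  "variance v (mixture w P d) \<le> (\<Sum>k\<in>UNIV. w k * (block d k \<bullet> block d k))"
proof -
  let ?N = "\<Sum>k\<in>UNIV. w k * (block d k \<bullet> block d k)"
  have "(mixture w P d $ i)\<^sup>2 \<le> ?N" for i
  proof -
    \<comment> \<open>Jensen for the weights \<open>w\<close>, as nonnegativity of the variance of \<open>k \<mapsto> (P\<^sub>k d\<^sub>k)\<^sub>i\<close>\<close>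
    have "(\<chi> k. w k) \<in> prob_simplex"
      using w by (simp add: prob_simplex_def less_imp_le)
    from mean_square_le[OF this, of "\<chi> k. P k $ i \<bullet> block d k"]
    have "(mixture w P d $ i)\<^sup>2 \<le> (\<Sum>k\<in>UNIV. w k * (P k $ i \<bullet> block d k)\<^sup>2)"
      by (simp add: mixture_nth inner_vec_def[of "\<chi> k. w k"])
    also have "\<dots> \<le> ?N"
      by (intro sum_mono mult_left_mono mean_square_le_norm P less_imp_le[OF w(1)])
    finally show ?thesis .
  qed
  then have "(\<Sum>i\<in>UNIV. v $ i * (mixture w P d $ i)\<^sup>2) \<le> (\<Sum>i\<in>UNIV. v $ i * ?N)"
    by (intro sum_mono mult_left_mono v_nonneg)
  also have "\<dots> = ?N"
    using v by (simp add: sum_distrib_right[symmetric] prob_simplex_def)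
  finally show ?thesis
    by (simp add: variance_def) (smt (verit) zero_le_power2)
qed

lemma within_le:
  "(\<Sum>i\<in>UNIV. v $ i * variance (P k $ i) (block d k)) \<le> (block d k \<bullet> block d k) / 2"
proof -
  have "(\<Sum>i\<in>UNIV. v $ i * variance (P k $ i) (block d k)) \<le> (\<Sum>i\<in>UNIV. v $ i * ((block d k \<bullet> block d k) / 2))"
    by (intro sum_mono mult_left_mono v_nonneg variance_le_half_norm P)
  also have "\<dots> = (block d k \<bullet> block d k) / 2"
    using v unfolding sum_distrib_right[symmetric] by (simp add: prob_simplex_def)
  finally show ?thesis .
qed

lemma quadratic_form_le:
  assumes "\<And>k. w k \<le> W"
  shows "d \<bullet> (H *v d) \<le> W * (1 / (2 * \<eta>) + 1 / \<tau>) * (d \<bullet> d)"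
proof -
  let ?N = "\<Sum>k\<in>UNIV. w k * (block d k \<bullet> block d k)"
  have "d \<bullet> (H *v d) \<le> ?N / \<tau> + (\<Sum>k\<in>UNIV. w k / \<eta> * ((block d k \<bullet> block d k) / 2))"
    unfolding quadratic_form using eta tau
    by (intro add_mono divide_right_mono between_le sum_mono mult_left_mono within_le)
      (auto simp: less_imp_le[OF w(1)])
  also have "\<dots> = (1 / (2 * \<eta>) + 1 / \<tau>) * ?N"
    by (simp add: sum_distrib_left sum_divide_distrib sum.distrib[symmetric] algebra_simps)
  also have "\<dots> \<le> (1 / (2 * \<eta>) + 1 / \<tau>) * (\<Sum>k\<in>UNIV. W * (block d k \<bullet> block d k))"
    using eta tau by (intro mult_left_mono sum_mono mult_right_mono assms) auto
  also have "\<dots> = W * (1 / (2 * \<eta>) + 1 / \<tau>) * (d \<bullet> d)"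
    by (simp add: inner_blocks[of d d] sum_distrib_left[symmetric] mult_ac)
  finally show ?thesis .
qed

end

section \<open>Gradient and Hessian of the objective\<close>

locale dual_problem =
  fixes \<eta> \<tau> :: real and \<mu> :: "'k::finite \<Rightarrow> real ^ 'm::finite"
    and C :: "'k \<Rightarrow> real ^ 'm ^ 'n::finite" and w :: "'k \<Rightarrow> real" and \<pi> :: "real ^ 'n"
  assumes eta: "0 < \<eta>" and tau: "0 < \<tau>"
    and mu: "\<And>k j. 0 < \<mu> k $ j" and pi: "\<And>i. 0 < \<pi> $ i"
begin

abbreviation v :: "real ^ ('k \<times> 'm) \<Rightarrow> real ^ 'n" where
  "v \<equiv> vvec \<eta> \<tau> \<mu> C w \<pi>"

abbreviation P :: "real ^ ('k \<times> 'm) \<Rightarrow> 'k \<Rightarrow> real ^ 'm ^ 'n" where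
  "P \<beta> k \<equiv> plan \<eta> (\<mu> k) (C k) (block \<beta> k)"

lemma plan_eq_gibbs:
  "P \<beta> k $ i $ j = gibbs (($) (\<mu> k)) (\<lambda>j. (block \<beta> k $ j - C k $ i $ j) / \<eta>) j"
  by (simp add: plan_def gibbs_def)

lemma vvec_eq_gibbs:
  "v \<beta> $ i = gibbs (($) \<pi>) (\<lambda>i. - (Phi \<eta> \<mu> C w \<beta> $ i) / \<tau>) i"
  by (simp add: vvec_def gibbs_def)

lemma plan_pos: "0 < P \<beta> k $ i $ j"
  unfolding plan_eq_gibbs by (rule gibbs_pos) (rule mu)

lemma plan_simplex: "P \<beta> k $ i \<in> prob_simplex"
  using plan_pos[of k \<beta> i] sum_gibbs[of "($) (\<mu> k)"] mu
  by (simp add: prob_simplex_def plan_eq_gibbs less_imp_le)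

lemma vvec_pos: "0 < v \<beta> $ i"
  unfolding vvec_eq_gibbs by (rule gibbs_pos) (rule pi)

lemma vvec_simplex: "v \<beta> \<in> prob_simplex"
  using vvec_pos[of \<beta>] sum_gibbs[of "($) \<pi>"] pi
  by (simp add: prob_simplex_def vvec_eq_gibbs less_imp_le)

lemma has_derivative_exponent:
  "((\<lambda>\<beta>. (block \<beta> k $ j - c) / \<eta>) has_derivative (\<lambda>h. block h k $ j / \<eta>)) (at \<beta>)"
  unfolding block_def vec_lambda_beta using eta
  by (auto intro!: derivative_eq_intros bounded_linear.has_derivative[OF bounded_linear_vec_nth])

lemma has_derivative_plan:
  "((\<lambda>\<beta>. P \<beta> k $ i $ j) has_derivative
     (\<lambda>h. P \<beta> k $ i $ j * ((h $ (k, j) - P \<beta> k $ i \<bullet> block h k) / \<eta>))) (at \<beta>)"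
proof -
  have "((\<lambda>\<beta>. P \<beta> k $ i $ j) has_derivative
     (\<lambda>h. P \<beta> k $ i $ j * (block h k $ j / \<eta> - (\<Sum>l\<in>UNIV. P \<beta> k $ i $ l * (block h k $ l / \<eta>))))) (at \<beta>)"
    unfolding plan_eq_gibbs by (intro has_derivative_gibbs mu has_derivative_exponent)
  then show ?thesis
    by (simp add: inner_vec_def block_def sum_divide_distrib[symmetric] diff_divide_distrib)
qed

lemma has_derivative_Phi:
  "((\<lambda>\<beta>. Phi \<eta> \<mu> C w \<beta> $ i) has_derivative (\<lambda>h. - mixture w (P \<beta>) h $ i)) (at \<beta>)"
proof -
  have D: "((\<lambda>\<beta>. ln (\<Sum>j\<in>UNIV. \<mu> k $ j * exp ((block \<beta> k $ j - C k $ i $ j) / \<eta>))) has_derivative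
      (\<lambda>h. \<Sum>j\<in>UNIV. P \<beta> k $ i $ j * (block h k $ j / \<eta>))) (at \<beta>)" for k
    unfolding plan_eq_gibbs by (intro has_derivative_log_partition mu has_derivative_exponent)
  have "((\<lambda>\<beta>. \<Sum>k\<in>UNIV. w k * (- \<eta> * ln (\<Sum>j\<in>UNIV. \<mu> k $ j * exp ((block \<beta> k $ j - C k $ i $ j) / \<eta>))))
      has_derivative (\<lambda>h. \<Sum>k\<in>UNIV. w k * (- \<eta> * (\<Sum>j\<in>UNIV. P \<beta> k $ i $ j * (block h k $ j / \<eta>))))) (at \<beta>)"
    by (intro has_derivative_sum has_derivative_mult_right D)
  moreover have "- \<eta> * (\<Sum>j\<in>UNIV. P \<beta> k $ i $ j * (block h k $ j / \<eta>)) = - (P \<beta> k $ i \<bullet> block h k)" for h k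
    using eta by (simp add: inner_vec_def sum_divide_distrib[symmetric])
  ultimately show ?thesis
    by (simp add: Phi_def alpha_def mixture_nth sum_negf)
qed

lemma has_derivative_neg_Phi:
  "((\<lambda>\<beta>. - (Phi \<eta> \<mu> C w \<beta> $ i) / \<tau>) has_derivative (\<lambda>h. mixture w (P \<beta>) h $ i / \<tau>)) (at \<beta>)"
  using tau by (auto intro!: derivative_eq_intros has_derivative_Phi)

lemma has_derivative_vvec:
  "((\<lambda>\<beta>. v \<beta> $ i) has_derivative
     (\<lambda>h. v \<beta> $ i * ((mixture w (P \<beta>) h $ i - v \<beta> \<bullet> mixture w (P \<beta>) h) / \<tau>))) (at \<beta>)"
proof -
  have "((\<lambda>\<beta>. v \<beta> $ i) has_derivative
     (\<lambda>h. v \<beta> $ i * (mixture w (P \<beta>) h $ i / \<tau> - (\<Sum>l\<in>UNIV. v \<beta> $ l * (mixture w (P \<beta>) h $ l / \<tau>))))) (at \<beta>)"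
    unfolding vvec_eq_gibbs by (intro has_derivative_gibbs pi has_derivative_neg_Phi)
  then show ?thesis
    by (simp add: inner_vec_def sum_divide_distrib[symmetric] diff_divide_distrib)
qed

definition grad :: "real ^ ('k \<times> 'm) \<Rightarrow> real ^ ('k \<times> 'm)" where
  "grad \<beta> = (\<chi> a. w (fst a) * ((\<Sum>i\<in>UNIV. v \<beta> $ i * P \<beta> (fst a) $ i $ snd a) - \<mu> (fst a) $ snd a))"

lemma gderiv_objective: "GDERIV (objective \<eta> \<tau> \<mu> C w \<pi>) \<beta> :> grad \<beta>"
proof -
  have "((\<lambda>\<beta>. ln (\<Sum>i\<in>UNIV. \<pi> $ i * exp (- (Phi \<eta> \<mu> C w \<beta> $ i) / \<tau>))) has_derivative
      (\<lambda>h. \<Sum>i\<in>UNIV. v \<beta> $ i * (mixture w (P \<beta>) h $ i / \<tau>))) (at \<beta>)"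
    unfolding vvec_eq_gibbs by (intro has_derivative_log_partition pi has_derivative_neg_Phi)
  moreover have "((\<lambda>\<beta>. block \<beta> k \<bullet> \<mu> k) has_derivative (\<lambda>h. block h k \<bullet> \<mu> k)) (at \<beta>)" for k
    unfolding inner_vec_def block_def vec_lambda_beta
    by (auto intro!: derivative_eq_intros bounded_linear.has_derivative[OF bounded_linear_vec_nth])
  ultimately have "(objective \<eta> \<tau> \<mu> C w \<pi> has_derivative
      (\<lambda>h. - (\<Sum>k\<in>UNIV. w k * (block h k \<bullet> \<mu> k)) + \<tau> * (\<Sum>i\<in>UNIV. v \<beta> $ i * (mixture w (P \<beta>) h $ i / \<tau>)))) (at \<beta>)"
    unfolding objective_def
    by (intro has_derivative_add has_derivative_minus has_derivative_sum has_derivative_mult_right)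
  moreover have "- (\<Sum>k\<in>UNIV. w k * (block h k \<bullet> \<mu> k)) + \<tau> * (\<Sum>i\<in>UNIV. v \<beta> $ i * (mixture w (P \<beta>) h $ i / \<tau>))
      = h \<bullet> grad \<beta>" for h
  proof -
    have "\<tau> * (\<Sum>i\<in>UNIV. v \<beta> $ i * (mixture w (P \<beta>) h $ i / \<tau>)) = (\<Sum>i\<in>UNIV. \<Sum>k\<in>UNIV. \<Sum>j\<in>UNIV.
        w k * (v \<beta> $ i * P \<beta> k $ i $ j * h $ (k, j)))"
      using tau by (simp add: sum_divide_distrib[symmetric])
        (simp add: mixture_nth inner_vec_def block_def sum_distrib_left mult_ac)
    also have "\<dots> = (\<Sum>k\<in>UNIV. \<Sum>i\<in>UNIV. \<Sum>j\<in>UNIV. w k * (v \<beta> $ i * P \<beta> k $ i $ j * h $ (k, j)))"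
      by (rule sum.swap)
    also have "\<dots> = (\<Sum>k\<in>UNIV. \<Sum>j\<in>UNIV. \<Sum>i\<in>UNIV. w k * (v \<beta> $ i * P \<beta> k $ i $ j * h $ (k, j)))"
      by (intro sum.cong refl sum.swap)
    finally show ?thesis
      by (simp add: inner_vec_def sum_UNIV_prod grad_def block_def right_diff_distrib sum_subtractf
          sum_distrib_left mult_ac)
  qed
  ultimately show ?thesis
    by (simp add: gderiv_def)
qed

lemma gradient_objective: "gradient (objective \<eta> \<tau> \<mu> C w \<pi>) = grad"
proof
  fix \<beta>
  show "gradient (objective \<eta> \<tau> \<mu> C w \<pi>) \<beta> = grad \<beta>"
    unfolding gradient_def
  proof (rule the_equality)
    show "GDERIV (objective \<eta> \<tau> \<mu> C w \<pi>) \<beta> :> grad \<beta>"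
      by (rule gderiv_objective)
  next
    fix g assume "GDERIV (objective \<eta> \<tau> \<mu> C w \<pi>) \<beta> :> g"
    then have "(\<lambda>h. h \<bullet> g) = (\<lambda>h. h \<bullet> grad \<beta>)"
      using gderiv_objective has_derivative_unique unfolding gderiv_def by blast
    then show "g = grad \<beta>"
      by (metis vector_eq_ldot)
  qed
qed

lemma has_derivative_grad:
  "(grad has_derivative (*v) (assemble (hess_block \<eta> \<tau> w (v \<beta>) (P \<beta>)))) (at \<beta>)"
proof -
  let ?H = "assemble (hess_block \<eta> \<tau> w (v \<beta>) (P \<beta>))"
  have "((\<lambda>\<beta>. grad \<beta> $ (k, j)) has_derivative (\<lambda>h. (?H *v h) $ (k, j))) (at \<beta>)" for k j
  proof -
    have "((\<lambda>\<beta>. w k * ((\<Sum>i\<in>UNIV. v \<beta> $ i * P \<beta> k $ i $ j) - \<mu> k $ j)) has_derivative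
      (\<lambda>h. w k * ((\<Sum>i\<in>UNIV. v \<beta> $ i * (P \<beta> k $ i $ j * ((h $ (k, j) - P \<beta> k $ i \<bullet> block h k) / \<eta>))
        + v \<beta> $ i * ((mixture w (P \<beta>) h $ i - v \<beta> \<bullet> mixture w (P \<beta>) h) / \<tau>) * P \<beta> k $ i $ j) - 0))) (at \<beta>)"
      by (intro has_derivative_mult_right has_derivative_diff has_derivative_const has_derivative_sum
          has_derivative_mult has_derivative_vvec has_derivative_plan)
    moreover have "v \<beta> $ i * (P \<beta> k $ i $ j * ((h $ (k, j) - P \<beta> k $ i \<bullet> block h k) / \<eta>))
        + v \<beta> $ i * ((mixture w (P \<beta>) h $ i - v \<beta> \<bullet> mixture w (P \<beta>) h) / \<tau>) * P \<beta> k $ i $ j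
      = v \<beta> $ i * P \<beta> k $ i $ j * ((mixture w (P \<beta>) h $ i - v \<beta> \<bullet> mixture w (P \<beta>) h) / \<tau>
        + (h $ (k, j) - P \<beta> k $ i \<bullet> block h k) / \<eta>)" for h i
      by (simp add: algebra_simps)
    ultimately show ?thesis
      unfolding assemble_hess_block_mult by (simp add: grad_def)
  qed
  then have "((\<lambda>\<beta>. grad \<beta> \<bullet> b) has_derivative (\<lambda>h. (?H *v h) \<bullet> b)) (at \<beta>)" if "b \<in> Basis" for b
    using that by (auto simp: Basis_vec_def inner_axis)
  then show ?thesis
    by (subst has_derivative_componentwise_within) blast
qed

text \<open>
  The unsparsified instance of the block matrix is the true Hessian, so the kernel description applies to it.
\<close>

lemma hessian_objective:
  "hessian (objective \<eta> \<tau> \<mu> C w \<pi>) \<beta> = assemble (hess_block \<eta> \<tau> w (v \<beta>) (P \<beta>))"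
  unfolding hessian_def gradient_objective jacobian_def
    frechet_derivative_at[OF has_derivative_grad, symmetric] by simp

text \<open>
  The entries of \<open>P\<^sub>k\<^sup>\<top> v\<close> sum to one, as do those of \<open>\<mu>\<^sub>k\<close>, so each block of the gradient sums to zero.
\<close>

lemma grad_orthogonal:
  assumes "\<And>k. \<mu> k \<in> prob_simplex" and "\<And>k. block d k = c k *\<^sub>R 1"
  shows "d \<bullet> grad \<beta> = 0"
proof -
  have dc: "d $ (k, j) = c k" for k j
    using arg_cong[OF assms(2)[of k], of "\<lambda>x. x $ j"] by (simp add: block_def)
  have "(\<Sum>j\<in>UNIV. \<Sum>i\<in>UNIV. v \<beta> $ i * P \<beta> k $ i $ j) = 1" for k
  proof -
    have "(\<Sum>j\<in>UNIV. \<Sum>i\<in>UNIV. v \<beta> $ i * P \<beta> k $ i $ j) = (\<Sum>i\<in>UNIV. v \<beta> $ i * (\<Sum>j\<in>UNIV. P \<beta> k $ i $ j))"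
      unfolding sum_distrib_left by (rule sum.swap)
    then show ?thesis
      using plan_simplex[of k \<beta>] vvec_simplex[of \<beta>] by (simp add: prob_simplex_def)
  qed
  moreover have "(\<Sum>j\<in>UNIV. \<mu> k $ j) = 1" for k
    using assms(1) by (simp add: prob_simplex_def)
  ultimately have "(\<Sum>j\<in>UNIV. grad \<beta> $ (k, j)) = 0" for k
    by (simp add: grad_def sum_distrib_left[symmetric] sum_subtractf)
  then show ?thesis
    by (simp add: inner_vec_def[of d] sum_UNIV_prod dc sum_distrib_left[symmetric])
qed

end

section \<open>The sparsified Hessian\<close>

lemma sparsify_row_simplex:
  assumes "P $ i \<in> prob_simplex" and "i \<noteq> i0 \<Longrightarrow> kept_mass \<rho> P i \<noteq> 0"
  shows "sparsify \<rho> i0 P $ i \<in> prob_simplex"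
proof (cases "i = i0")
  case True
  then have "sparsify \<rho> i0 P $ i = P $ i"
    by (simp add: sparsify_def vec_eq_iff)
  then show ?thesis using assms(1) by simp
next
  case False
  have nn: "0 \<le> P $ i $ j" for j
    using assms(1) by (simp add: prob_simplex_def)
  then have "0 \<le> kept_mass \<rho> P i"
    by (auto simp: kept_mass_def intro!: sum_nonneg)
  moreover have "(\<Sum>j\<in>UNIV. P $ i $ j * of_bool (\<rho> \<le> P $ i $ j) / kept_mass \<rho> P i) = 1"
    using assms(2)[OF False] unfolding sum_divide_distrib[symmetric] kept_mass_def[symmetric] by simp
  ultimately show ?thesis
    using False nn by (simp add: prob_simplex_def sparsify_def)
qed

theorem proposition4p1:
  fixes \<eta> \<tau> \<rho> :: real
    and \<mu> :: "'k::finite \<Rightarrow> real ^ 'm::finite"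
    and C :: "'k \<Rightarrow> real ^ 'm ^ 'n::finite"
    and w :: "'k \<Rightarrow> real"
    and \<pi> :: "real ^ 'n"
    and \<beta> :: "real ^ ('k \<times> 'm)"
    and istar :: 'n
  assumes "0 < \<eta>" and "0 < \<tau>"
    and "\<And>k. \<mu> k \<in> prob_simplex" and "\<And>k j. 0 < \<mu> k $ j"
    and "\<And>k i j. 0 \<le> C k $ i $ j"
    and "\<And>k. 0 < w k" and "(\<Sum>k\<in>UNIV. w k) = 1"
    and "\<pi> \<in> prob_simplex" and "\<And>i. 0 < \<pi> $ i"
    and "0 \<le> \<rho>"
    and "\<And>i. vvec \<eta> \<tau> \<mu> C w \<pi> \<beta> $ i \<le> vvec \<eta> \<tau> \<mu> C w \<pi> \<beta> $ istar"
    and "\<And>k i. i \<noteq> istar \<Longrightarrow> kept_mass \<rho> (plan \<eta> (\<mu> k) (C k) (block \<beta> k)) i \<noteq> 0"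
  shows "let L = objective \<eta> \<tau> \<mu> C w \<pi>;
             g = gradient L \<beta>;
             H = hessian L \<beta>;
             H\<^sub>\<rho> = sparsified_hessian \<eta> \<tau> \<mu> C w \<pi> \<rho> istar \<beta>;
             p = (\<lambda>k. MIN j. sparsify \<rho> istar (plan \<eta> (\<mu> k) (C k) (block \<beta> k)) $ istar $ j)
         in ker H\<^sub>\<rho> = ker H
          \<and> ker H = {d. \<exists>c :: 'k \<Rightarrow> real. \<forall>k. block d k = c k *\<^sub>R 1}
          \<and> symmetric_matrix H\<^sub>\<rho> \<and> psd_matrix H\<^sub>\<rho>
          \<and> g \<in> orthogonal_comp (ker H\<^sub>\<rho>)
          \<and> (\<exists>d. H\<^sub>\<rho> *v d = - g)
          \<and> ((\<exists>l \<in> eigenvalues H\<^sub>\<rho>. 0 < l) \<longrightarrow>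
               lambda_min_pos H\<^sub>\<rho> \<ge> real CARD('m) / (\<eta> * real CARD('n)) * (MIN k. w k * (p k)\<^sup>2))
          \<and> lambda_max H\<^sub>\<rho> \<le> (MAX k. w k) * (1 / (2 * \<eta>) + 1 / \<tau>)"
proof -
  interpret D: dual_problem \<eta> \<tau> \<mu> C w \<pi>
    using assms(1,2,4,9) by unfold_locales
  define R where "R = (\<lambda>k. sparsify \<rho> istar (D.P \<beta> k))"
  define p where "p = (\<lambda>k. MIN j. R k $ istar $ j)"
  interpret E: stochastic_family \<eta> \<tau> w "D.v \<beta>" "D.P \<beta>"
    using assms(1,2,6,7) by unfold_locales (auto intro: D.vvec_simplex D.plan_simplex)
  interpret S: stochastic_family \<eta> \<tau> w "D.v \<beta>" R
    using assms(1,2,6,7,12) D.vvec_simplex by unfold_locales (auto simp: R_def intro: sparsify_row_simplex D.plan_simplex)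
  let ?K = "{d :: real ^ ('k \<times> 'm). \<exists>c. \<forall>k. block d k = c k *\<^sub>R 1}"
  have Rpos: "0 < R k $ istar $ j" for k j
    using D.plan_pos by (simp add: R_def sparsify_def)
  have kE: "ker E.H = ?K"
    by (rule E.kernel[OF D.vvec_pos D.plan_pos])
  have kS: "ker S.H = ?K"
    by (rule S.kernel[OF D.vvec_pos Rpos])
  have sym: "symmetric_matrix S.H"
    by (rule symmetric_assemble_hess_block)
  have orth: "D.grad \<beta> \<in> orthogonal_comp (ker S.H)"
    using D.grad_orthogonal[OF assms(3)] by (auto simp: kS orthogonal_comp_def orthogonal_def)
  have solv: "\<exists>d. S.H *v d = - D.grad \<beta>"
    using orth by (intro symmetric_solvable[OF sym]) (simp add: subspace_neg subspace_orthogonal_comp)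
  have fin: "finite (eigenvalues S.H)"
    by (rule finite_eigenvalues[OF sym])
  have p_le: "p k \<le> R k $ istar $ j" for k j
    by (simp add: p_def)
  have p_nonneg: "0 \<le> p k" for k
    by (simp add: p_def less_imp_le[OF Rpos])
  define q where "q = (MIN k. w k * (p k)\<^sup>2)"
  have q_le: "q \<le> w k * (p k)\<^sup>2" for k
    by (simp add: q_def)
  have q_nonneg: "0 \<le> q"
    by (simp add: q_def less_imp_le[OF assms(6)])
  have lower: "real CARD('m) / (\<eta> * real CARD('n)) * q \<le> l"
    if l: "l \<in> eigenvalues S.H" "0 < l" for l
  proof -
    obtain x where x: "x \<noteq> 0" "S.H *v x = l *\<^sub>R x"
      using l(1) by (auto simp: eigenvalues_def)
    have "(\<Sum>j\<in>UNIV. block x k $ j) = 0" for k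
    proof -
      \<comment> \<open>orthogonality to the indicator vector of block \<open>k\<close>, which is blockwise constant\<close>
      let ?y = "(\<chi> a. if fst a = k then 1 else 0) :: real ^ ('k \<times> 'm)"
      have "?y \<in> ker S.H"
        unfolding kS by (auto simp: vec_eq_iff block_def intro!: exI[of _ "\<lambda>r. if r = k then 1 else 0"])
      then have "x \<bullet> ?y = 0"
        using eigenvector_orthogonal_kernel[OF sym x(2)] l(2) by simp
      moreover have "x \<bullet> ?y = (\<Sum>r\<in>UNIV. if r = k then \<Sum>j\<in>UNIV. block x r $ j else 0)"
        unfolding inner_vec_def sum_UNIV_prod by (intro sum.cong) (auto simp: block_def)
      ultimately show ?thesis by simp
    qed
    then have "real CARD('m) / (\<eta> * real CARD('n)) * q * (x \<bullet> x) \<le> l * (x \<bullet> x)"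
      using S.quadratic_form_ge[OF assms(11) p_nonneg p_le _ q_le q_nonneg, of x] by (simp add: x(2))
    then show ?thesis
      using x(1) by (simp only: mult_le_cancel_right) auto
  qed
  have upper: "l \<le> (MAX k. w k) * (1 / (2 * \<eta>) + 1 / \<tau>)" if l: "l \<in> eigenvalues S.H" for l
  proof -
    obtain x where x: "x \<noteq> 0" "S.H *v x = l *\<^sub>R x"
      using l by (auto simp: eigenvalues_def)
    have "l * (x \<bullet> x) \<le> (MAX k. w k) * (1 / (2 * \<eta>) + 1 / \<tau>) * (x \<bullet> x)"
      using S.quadratic_form_le[of "MAX k. w k" x] by (simp add: x(2))
    then show ?thesis
      using x(1) by (simp only: mult_le_cancel_right) auto
  qed
  \<comment> \<open>the spectrum is nonempty, so that its maximum is bounded by \<open>upper\<close>\<close>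
  have "1 \<in> ker S.H"
    unfolding kS by (auto simp: vec_eq_iff block_def intro!: exI[of _ "\<lambda>_. 1"])
  then have zero: "0 \<in> eigenvalues S.H"
    by (auto simp: eigenvalues_def ker_def intro!: exI[of _ 1])
  have lmax: "lambda_max S.H \<le> (MAX k. w k) * (1 / (2 * \<eta>) + 1 / \<tau>)"
    unfolding lambda_max_def using fin zero by (intro Max.boundedI upper) auto
  have lmin: "real CARD('m) / (\<eta> * real CARD('n)) * q \<le> lambda_min_pos S.H"
    if "\<exists>l\<in>eigenvalues S.H. 0 < l"
    unfolding lambda_min_pos_def using fin that by (intro Min.boundedI lower) auto
  have HS: "sparsified_hessian \<eta> \<tau> \<mu> C w \<pi> \<rho> istar \<beta> = S.H"
    by (simp add: sparsified_hessian_def R_def)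
  show ?thesis
    unfolding Let_def HS D.hessian_objective D.gradient_objective
    using kE kS sym S.psd orth solv lmax lmin by (auto simp: p_def q_def R_def)
qed

end
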